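(* There exists a labelled symmetric precubical set $K$ satisfying the HDA paradigm which is not strong, i.e. such that $\mathbb T(K)$ does not satisfy the Unique intermediate state axiom.
   Context: $\Sigma$ is a fixed nonempty set of labels. A weak higher dimensional transition system is a triple $(S,\mu:L\to\Sigma,T=\bigcup_{n\ge1}T_n)$ with $S$ a set (states), $L$ a set (actions), $\mu$ a set map (labelling map) and $T_n\subset S\times L^n\times S$ ($n$-transitions) such that: - (Multiset axiom) for every permutation $\sigma$ of $\{1,\dots,n\}$, $n\ge2$, if $(\alpha,u_1,\dots,u_n,\beta)\in T$ then $(\alpha,u_{\sigma(1)},\dots,u_{\sigma(n)},\beta)\in T$; - (Coherence axiom) for $n\ge3$, $p,q\ge1$ with $p+q<n$, if $(\alpha,u_1,\dots,u_n,\beta)$, $(\alpha,u_1,\dots,u_p,\nu_1)$, $(\nu_1,u_{p+1},\dots,u_n,\beta)$, $(\alpha,u_1,\dots,u_{p+q},\nu_2)$, $(\nu_2,u_{p+q+1},\dots,u_n,\beta)$ are transitions, then $(\nu_1,u_{p+1},\dots,u_{p+q},\nu_2)$ is a transition. A morphism $f$ consists of a map $f_0$ on states and a map $\widetilde f$ on actions commuting with the labelling maps, such that $(f_0(\alpha),\widetilde f(u_1),\dots,\widetilde f(u_n),f_0(\beta))$ is a transition whenever $(\alpha,u_1,\dots,u_n,\beta)$ is. The category is $\mathbf{WHDTS}$. The Unique intermediate state axiom: for every $n\ge2$, $1\le p<n$ and transition $(\alpha,u_1,\dots,u_n,\beta)$ there is a unique state $\nu$ such that $(\alpha,u_1,\dots,u_p,\nu)$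 and $(\nu,u_{p+1},\dots,u_n,\beta)$ are transitions. $C_n[a_1,\dots,a_n]$ ($n\ge0$, $a_i\in\Sigma$) has set of states $\{0,1\}^n$, set of actions $\{(a_1,1),\dots,(a_n,n)\}$, labelling $\mu(a_i,i)=a_i$, and its $d$-transitions ($d\ge1$) are the tuples $((\epsilon_1,\dots,\epsilon_n),(a_{i_1},i_1),\dots,(a_{i_d},i_d),(\epsilon_1',\dots,\epsilon_n'))$ with $i_1,\dots,i_d$ pairwise distinct, $\epsilon_i\le\epsilon_i'$ for all $i$, and $\epsilon_i\ne\epsilon_i'$ iff $i\in\{i_1,\dots,i_d\}$. $\square_S$ is the category with objects $[n]=\{0,1\}^n$, $n\ge0$, whose morphisms are the set maps generated by the face maps $\delta_i^\alpha(\epsilon_1,\dots,\epsilon_{n-1})=(\epsilon_1,\dots,\epsilon_{i-1},\alpha,\epsilon_i,\dots,\epsilon_{n-1})$ ($\alpha\in\{0,1\}$) and the symmetry maps $\sigma_i:[n]\to[n]$ exchanging coordinates $i$ and $i+1$. A symmetric precubical set is a presheaf on $\square_S$; $\square_S[n]=\square_S(-,[n])$; $\partial\square_S[n]\subset\square_S[n]$ has the same $k$-cubes for $k<n$ and none for $k\ge n$. The symmetric precubical set $!^S\Sigma$ has $(!^S\Sigma)_n=\Sigma^n$, where $(\delta_i^0)^*=(\delta_i^1)^*$ removes the $i$-th letter and $\sigma_i^*$ exchanges letters $i$ and $i+1$. A labelled symmetric precubical set is an object of the comma category $\square_S^{op}\mathbf{Set}\downarrow{!^S\Sigma}$. The labelled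 cube $\square_S[a_1,\dots,a_n]$ is $\square_S[n]\to{!^S\Sigma}$ corresponding to $(a_1,\dots,a_n)\in\Sigma^n$. $\mathbb T:\square_S^{op}\mathbf{Set}\downarrow{!^S\Sigma}\to\mathbf{WHDTS}$ is the colimit-preserving functor with $\mathbb T(\square_S[a_1,\dots,a_n])=C_n[a_1,\dots,a_n]$ and defined on a map of cubes $f:\square_S[a_1,\dots,a_m]\to\square_S[b_1,\dots,b_n]$ as follows: on states it is $f_0:[m]\to[n]$; there is a unique $\widehat f:\{1,\dots,n\}\to\{1,\dots,m\}\cup\{-\infty,+\infty\}$ with $f_0(\epsilon_1,\dots,\epsilon_m)=(\epsilon_{\widehat f(1)},\dots,\epsilon_{\widehat f(n)})$ (with $\epsilon_{-\infty}=0$, $\epsilon_{+\infty}=1$), each $i\in\{1,\dots,m\}$ has exactly one preimage $j$ under $\widehat f$, and on actions $(a_i,i)\mapsto(b_j,j)=(a_i,j)$. A labelled symmetric precubical set $K\to{!^S\Sigma}$ satisfies the HDA paradigm if for every $p\ge2$, every commutative square with sides $\partial\square_S[p]\subset\square_S[p]$, $\partial\square_S[p]\to K$, $\square_S[p]\to{!^S\Sigma}$ and $K\to{!^S\Sigma}$ admits at most one lift $k:\square_S[p]\to K$. *)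

theory Defs
  imports "HOL-Library.FuncSet" "HOL-Combinatorics.Permutations"
begin

section \<open>Weak higher dimensional transition systems\<close>

text \<open>
  The label set is the type \<open>'a\<close>, hence nonempty.  Coordinates, letters and actions of cubes are
  numbered from \<open>0\<close>.
\<close>

record ('s, 'l, 'a) hdts =
  states :: "'s set"
  actions :: "'l set"
  lab :: "'l \<Rightarrow> 'a"
  trans :: "('s \<times> 'l list \<times> 's) set"

definition multiset_axiom :: "('s \<times> 'l list \<times> 's) set \<Rightarrow> bool" where
  "multiset_axiom T \<longleftrightarrow>
     (\<forall>\<alpha> us \<beta> \<sigma>. length us \<ge> 2 \<longrightarrow> \<sigma> permutes {..<length us} \<longrightarrow> (\<alpha>, us, \<beta>) \<in> T \<longrightarrow>
        (\<alpha>, permute_list \<sigma> us, \<beta>) \<in> T)"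

definition coherence_axiom :: "('s \<times> 'l list \<times> 's) set \<Rightarrow> bool" where
  "coherence_axiom T \<longleftrightarrow>
     (\<forall>\<alpha> us \<beta> p q \<nu>1 \<nu>2. length us \<ge> 3 \<longrightarrow> p \<ge> 1 \<longrightarrow> q \<ge> 1 \<longrightarrow> p + q < length us \<longrightarrow>
        (\<alpha>, us, \<beta>) \<in> T \<longrightarrow>
        (\<alpha>, take p us, \<nu>1) \<in> T \<longrightarrow> (\<nu>1, drop p us, \<beta>) \<in> T \<longrightarrow>
        (\<alpha>, take (p + q) us, \<nu>2) \<in> T \<longrightarrow> (\<nu>2, drop (p + q) us, \<beta>) \<in> T \<longrightarrow>
        (\<nu>1, take q (drop p us), \<nu>2) \<in> T)"

definition whdts :: "('s, 'l, 'a) hdts \<Rightarrow> bool" where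
  "whdts X \<longleftrightarrow>
     (\<forall>(\<alpha>, us, \<beta>) \<in> trans X.
        length us \<ge> 1 \<and> \<alpha> \<in> states X \<and> set us \<subseteq> actions X \<and> \<beta> \<in> states X) \<and>
     multiset_axiom (trans X) \<and> coherence_axiom (trans X)"

definition whdts_hom ::
  "('s, 'l, 'a) hdts \<Rightarrow> ('t, 'k, 'a) hdts \<Rightarrow> ('s \<Rightarrow> 't) \<Rightarrow> ('l \<Rightarrow> 'k) \<Rightarrow> bool" where
  "whdts_hom X Y f0 f1 \<longleftrightarrow>
     (\<forall>s \<in> states X. f0 s \<in> states Y) \<and>
     (\<forall>u \<in> actions X. f1 u \<in> actions Y \<and> lab Y (f1 u) = lab X u) \<and>
     (\<forall>(\<alpha>, us, \<beta>) \<in> trans X. (f0 \<alpha>, map f1 us, f0 \<beta>) \<in> trans Y)"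

definition unique_intermediate_state :: "('s, 'l, 'a) hdts \<Rightarrow> bool" where
  "unique_intermediate_state X \<longleftrightarrow>
     (\<forall>\<alpha> us \<beta> p. length us \<ge> 2 \<longrightarrow> 1 \<le> p \<longrightarrow> p < length us \<longrightarrow> (\<alpha>, us, \<beta>) \<in> trans X \<longrightarrow>
        (\<exists>!\<nu>. \<nu> \<in> states X \<and> (\<alpha>, take p us, \<nu>) \<in> trans X \<and> (\<nu>, drop p us, \<beta>) \<in> trans X))"

definition vertices :: "nat \<Rightarrow> bool list set" where
  "vertices n = {\<epsilon>. length \<epsilon> = n}"

text \<open>The cube \<open>C\<^sub>n[a\<^sub>1,\<dots>,a\<^sub>n]\<close>, with \<open>n\<close> the length of the argument.\<close>

definition cube_ts :: "'a list \<Rightarrow> (bool list, 'a \<times> nat, 'a) hdts" where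
  "cube_ts as =
     \<lparr>states = vertices (length as),
      actions = {(as ! i, i) |i. i < length as},
      lab = fst,
      trans = {(\<epsilon>, us, \<epsilon>').
         \<epsilon> \<in> vertices (length as) \<and> \<epsilon>' \<in> vertices (length as) \<and>
         length us \<ge> 1 \<and> set us \<subseteq> {(as ! i, i) |i. i < length as} \<and> distinct (map snd us) \<and>
         (\<forall>i < length as. \<epsilon> ! i \<le> \<epsilon>' ! i \<and> (\<epsilon> ! i \<noteq> \<epsilon>' ! i \<longleftrightarrow> i \<in> set (map snd us)))}\<rparr>"


section \<open>Symmetric precubical sets\<close>

definition face :: "nat \<Rightarrow> nat \<Rightarrow> bool \<Rightarrow> bool list \<Rightarrow> bool list" where
  "face n i \<alpha> = restrict (\<lambda>\<epsilon>. take i \<epsilon> @ \<alpha> # drop i \<epsilon>) (vertices n)"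

definition symm :: "nat \<Rightarrow> nat \<Rightarrow> bool list \<Rightarrow> bool list" where
  "symm n i = restrict (\<lambda>\<epsilon>. \<epsilon>[i := \<epsilon> ! Suc i, Suc i := \<epsilon> ! i]) (vertices n)"

text \<open>\<open>box_hom m n f\<close>: the map \<open>f\<close>, extensional on \<open>[m]\<close>, is a morphism \<open>[m] \<rightarrow> [n]\<close>.\<close>

inductive box_hom :: "nat \<Rightarrow> nat \<Rightarrow> (bool list \<Rightarrow> bool list) \<Rightarrow> bool" where
  ident: "box_hom n n (restrict id (vertices n))"
| face: "i \<le> n \<Longrightarrow> box_hom n (Suc n) (face n i \<alpha>)"
| symm: "Suc i < n \<Longrightarrow> box_hom n n (symm n i)"
| comp: "box_hom l m f \<Longrightarrow> box_hom m n g \<Longrightarrow> box_hom l n (compose (vertices l) g f)"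

text \<open>\<open>pull K m n f\<close> is the map \<open>f\<^sup>*\<close> from \<open>n\<close>-cubes to \<open>m\<close>-cubes induced by \<open>f : [m] \<rightarrow> [n]\<close>.\<close>

record 'c presheaf =
  cubes :: "nat \<Rightarrow> 'c set"
  pull :: "nat \<Rightarrow> nat \<Rightarrow> (bool list \<Rightarrow> bool list) \<Rightarrow> 'c \<Rightarrow> 'c"

definition sym_precubical :: "'c presheaf \<Rightarrow> bool" where
  "sym_precubical K \<longleftrightarrow>
     (\<forall>m n f. box_hom m n f \<longrightarrow> (\<forall>x \<in> cubes K n. pull K m n f x \<in> cubes K m)) \<and>
     (\<forall>n. \<forall>x \<in> cubes K n. pull K n n (restrict id (vertices n)) x = x) \<and>
     (\<forall>l m n f g. box_hom l m f \<longrightarrow> box_hom m n g \<longrightarrow>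
        (\<forall>x \<in> cubes K n. pull K l n (compose (vertices l) g f) x = pull K l m f (pull K m n g x)))"

definition precubical_map :: "'c presheaf \<Rightarrow> 'd presheaf \<Rightarrow> (nat \<Rightarrow> 'c \<Rightarrow> 'd) \<Rightarrow> bool" where
  "precubical_map K L k \<longleftrightarrow>
     (\<forall>n. \<forall>x \<in> cubes K n. k n x \<in> cubes L n) \<and>
     (\<forall>m n f. box_hom m n f \<longrightarrow>
        (\<forall>x \<in> cubes K n. k m (pull K m n f x) = pull L m n f (k n x)))"

definition std_cube :: "nat \<Rightarrow> (bool list \<Rightarrow> bool list) presheaf" where
  "std_cube p = \<lparr>cubes = (\<lambda>k. {g. box_hom k p g}), pull = (\<lambda>m n f g. compose (vertices m) g f)\<rparr>"

definition boundary :: "nat \<Rightarrow> (bool list \<Rightarrow> bool list) presheaf" where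
  "boundary p = (std_cube p)\<lparr>cubes := (\<lambda>k. if k < p then cubes (std_cube p) k else {})\<rparr>"

datatype ext_index = NegInf | PosInf | Ix nat

fun ext_nth :: "bool list \<Rightarrow> ext_index \<Rightarrow> bool" where
  "ext_nth \<epsilon> NegInf = False"
| "ext_nth \<epsilon> PosInf = True"
| "ext_nth \<epsilon> (Ix i) = \<epsilon> ! i"

definition is_hat ::
  "nat \<Rightarrow> nat \<Rightarrow> (bool list \<Rightarrow> bool list) \<Rightarrow> (nat \<Rightarrow> ext_index) \<Rightarrow> bool" where
  "is_hat m n f g \<longleftrightarrow>
     g \<in> {..<n} \<rightarrow>\<^sub>E {NegInf, PosInf} \<union> Ix ` {..<m} \<and>
     (\<forall>\<epsilon> \<in> vertices m. f \<epsilon> = map (\<lambda>j. ext_nth \<epsilon> (g j)) [0..<n])"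

definition hat :: "nat \<Rightarrow> nat \<Rightarrow> (bool list \<Rightarrow> bool list) \<Rightarrow> nat \<Rightarrow> ext_index" where
  "hat m n f = (THE g. is_hat m n f g)"

definition hat_preimage :: "nat \<Rightarrow> nat \<Rightarrow> (bool list \<Rightarrow> bool list) \<Rightarrow> nat \<Rightarrow> nat" where
  "hat_preimage m n f i = (THE j. j < n \<and> hat m n f j = Ix i)"

text \<open>
  \<open>!\<^sup>S\<Sigma>\<close>.  The restriction map is written for an arbitrary morphism; that the generators delete,
  respectively exchange, letters is shown in \<open>pull_bang_face\<close> and \<open>pull_bang_symm\<close> below.
\<close>

definition bang :: "'a list presheaf" where
  "bang = \<lparr>cubes = (\<lambda>n. {w. length w = n}),
           pull = (\<lambda>m n f w. map (\<lambda>i. w ! hat_preimage m n f i) [0..<m])\<rparr>"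

definition labelled :: "'c presheaf \<Rightarrow> (nat \<Rightarrow> 'c \<Rightarrow> 'a list) \<Rightarrow> bool" where
  "labelled K lbl \<longleftrightarrow> sym_precubical K \<and> precubical_map K bang lbl"

definition is_lift ::
  "nat \<Rightarrow> 'c presheaf \<Rightarrow> (nat \<Rightarrow> 'c \<Rightarrow> 'a list) \<Rightarrow>
   (nat \<Rightarrow> (bool list \<Rightarrow> bool list) \<Rightarrow> 'c) \<Rightarrow> (nat \<Rightarrow> (bool list \<Rightarrow> bool list) \<Rightarrow> 'a list) \<Rightarrow>
   (nat \<Rightarrow> (bool list \<Rightarrow> bool list) \<Rightarrow> 'c) \<Rightarrow> bool" where
  "is_lift p K lbl g h k \<longleftrightarrow>
     precubical_map (std_cube p) K k \<and>
     (\<forall>n. \<forall>x \<in> cubes (boundary p) n. k n x = g n x) \<and>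
     (\<forall>n. \<forall>x \<in> cubes (std_cube p) n. lbl n (k n x) = h n x)"

definition HDA_paradigm :: "'c presheaf \<Rightarrow> (nat \<Rightarrow> 'c \<Rightarrow> 'a list) \<Rightarrow> bool" where
  "HDA_paradigm K lbl \<longleftrightarrow>
     (\<forall>p \<ge> 2. \<forall>g h.
        precubical_map (boundary p) K g \<longrightarrow> precubical_map (std_cube p) bang h \<longrightarrow>
        (\<forall>n. \<forall>x \<in> cubes (boundary p) n. lbl n (g n x) = h n x) \<longrightarrow>
        (\<forall>k k'. is_lift p K lbl g h k \<longrightarrow> is_lift p K lbl g h k' \<longrightarrow>
           (\<forall>n. \<forall>x \<in> cubes (std_cube p) n. k n x = k' n x)))"


section \<open>The realization functor on objects\<close>
definition equiv_closure :: "('b \<times> 'b) set \<Rightarrow> ('b \<times> 'b) set" where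
  "equiv_closure r = (r \<union> r\<inverse>)\<^sup>*"

inductive_set whdts_closure :: "('s \<times> 'l list \<times> 's) set \<Rightarrow> ('s \<times> 'l list \<times> 's) set"
  for G where
  gen: "t \<in> G \<Longrightarrow> t \<in> whdts_closure G"
| mset: "\<lbrakk>length us \<ge> 2; \<sigma> permutes {..<length us}; (\<alpha>, us, \<beta>) \<in> whdts_closure G\<rbrakk> \<Longrightarrow>
    (\<alpha>, permute_list \<sigma> us, \<beta>) \<in> whdts_closure G"
| coh: "\<lbrakk>length us \<ge> 3; p \<ge> 1; q \<ge> 1; p + q < length us;
    (\<alpha>, us, \<beta>) \<in> whdts_closure G;
    (\<alpha>, take p us, \<nu>1) \<in> whdts_closure G; (\<nu>1, drop p us, \<beta>) \<in> whdts_closure G;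
    (\<alpha>, take (p + q) us, \<nu>2) \<in> whdts_closure G; (\<nu>2, drop (p + q) us, \<beta>) \<in> whdts_closure G\<rbrakk> \<Longrightarrow>
    (\<nu>1, take q (drop p us), \<nu>2) \<in> whdts_closure G"

text \<open>The effect on actions of a map \<open>f : [m] \<rightarrow> [n]\<close> of labelled cubes; on states it is \<open>f\<close> itself.\<close>

definition cube_map_action ::
  "nat \<Rightarrow> nat \<Rightarrow> (bool list \<Rightarrow> bool list) \<Rightarrow> 'a \<times> nat \<Rightarrow> 'a \<times> nat" where
  "cube_map_action m n f u = (fst u, hat_preimage m n f (snd u))"

text \<open>
  \<open>K\<close> is the colimit of its labelled cubes, indexed by the pairs \<open>(n, x)\<close> with \<open>x\<close> an \<open>n\<close>-cube and
  with an arrow \<open>(m, f\<^sup>*x) \<rightarrow> (n, x)\<close> for every \<open>f : [m] \<rightarrow> [n]\<close>.  As the functor preserves colimits,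
  its value on \<open>K\<close> is the colimit of the corresponding diagram of cubes \<open>C\<^sub>n[lbl n x]\<close> in WHDTS.
  This colimit is constructed here: states and actions are glued, and the transitions are the
  smallest set containing the images of all transitions of the cubes and satisfying the two axioms.
  Its universal property, with respect to systems over arbitrary types, is
  \<open>realization_universal\<close> below.
\<close>

definition cube_states :: "'c presheaf \<Rightarrow> (nat \<times> 'c \<times> bool list) set" where
  "cube_states K = {(n, x, \<epsilon>). x \<in> cubes K n \<and> \<epsilon> \<in> vertices n}"

definition state_eq :: "'c presheaf \<Rightarrow> ((nat \<times> 'c \<times> bool list) \<times> (nat \<times> 'c \<times> bool list)) set" where
  "state_eq K = equiv_closure
     {((m, pull K m n f x, \<epsilon>), (n, x, f \<epsilon>)) |m n f x \<epsilon>.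
        box_hom m n f \<and> x \<in> cubes K n \<and> \<epsilon> \<in> vertices m}"

definition cube_actions ::
  "'c presheaf \<Rightarrow> (nat \<Rightarrow> 'c \<Rightarrow> 'a list) \<Rightarrow> (nat \<times> 'c \<times> 'a \<times> nat) set" where
  "cube_actions K lbl = {(n, x, u). x \<in> cubes K n \<and> u \<in> actions (cube_ts (lbl n x))}"

definition action_eq ::
  "'c presheaf \<Rightarrow> (nat \<Rightarrow> 'c \<Rightarrow> 'a list) \<Rightarrow>
   ((nat \<times> 'c \<times> 'a \<times> nat) \<times> (nat \<times> 'c \<times> 'a \<times> nat)) set" where
  "action_eq K lbl = equiv_closure
     {((m, pull K m n f x, u), (n, x, cube_map_action m n f u)) |m n f x u.
        box_hom m n f \<and> x \<in> cubes K n \<and> u \<in> actions (cube_ts (lbl m (pull K m n f x)))}"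

definition state_in :: "'c presheaf \<Rightarrow> nat \<Rightarrow> 'c \<Rightarrow> bool list \<Rightarrow> (nat \<times> 'c \<times> bool list) set" where
  "state_in K n x \<epsilon> = state_eq K `` {(n, x, \<epsilon>)}"

definition action_in ::
  "'c presheaf \<Rightarrow> (nat \<Rightarrow> 'c \<Rightarrow> 'a list) \<Rightarrow> nat \<Rightarrow> 'c \<Rightarrow> 'a \<times> nat \<Rightarrow> (nat \<times> 'c \<times> 'a \<times> nat) set" where
  "action_in K lbl n x u = action_eq K lbl `` {(n, x, u)}"

definition realization ::
  "'c presheaf \<Rightarrow> (nat \<Rightarrow> 'c \<Rightarrow> 'a list) \<Rightarrow>
   ((nat \<times> 'c \<times> bool list) set, (nat \<times> 'c \<times> 'a \<times> nat) set, 'a) hdts" where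
  "realization K lbl =
     \<lparr>states = cube_states K // state_eq K,
      actions = cube_actions K lbl // action_eq K lbl,
      lab = (\<lambda>c. THE a. \<exists>n x i. (n, x, a, i) \<in> c),
      trans = whdts_closure
        {(state_in K n x \<alpha>, map (action_in K lbl n x) us, state_in K n x \<beta>) |n x \<alpha> us \<beta>.
           x \<in> cubes K n \<and> (\<alpha>, us, \<beta>) \<in> trans (cube_ts (lbl n x))}\<rparr>"

definition strong :: "'c presheaf \<Rightarrow> (nat \<Rightarrow> 'c \<Rightarrow> 'a list) \<Rightarrow> bool" where
  "strong K lbl \<longleftrightarrow> unique_intermediate_state (realization K lbl)"


section \<open>Well-definedness and universal property\<close>

lemma box_hom_vertices: "box_hom m n f \<Longrightarrow> \<epsilon> \<in> vertices m \<Longrightarrow> f \<epsilon> \<in> vertices n"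
  by (induction arbitrary: \<epsilon> rule: box_hom.induct)
     (auto simp: vertices_def face_def symm_def compose_def)

lemma box_hom_extensional: "box_hom m n f \<Longrightarrow> f \<in> extensional (vertices m)"
  by (induction rule: box_hom.induct) (simp_all only: face_def symm_def restrict_extensional compose_extensional)

lemma box_hom_le: "box_hom m n f \<Longrightarrow> m \<le> n"
  by (induction rule: box_hom.induct) auto

lemma is_hat_unique:
  assumes "is_hat m n f g" "is_hat m n f g'"
  shows "g = g'"
proof (rule PiE_ext)
  show "g \<in> {..<n} \<rightarrow>\<^sub>E {NegInf, PosInf} \<union> Ix ` {..<m}"
    "g' \<in> {..<n} \<rightarrow>\<^sub>E {NegInf, PosInf} \<union> Ix ` {..<m}"
    using assms by (auto simp: is_hat_def)
  fix j assume j: "j \<in> {..<n}"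
  have eq: "ext_nth \<epsilon> (g j) = ext_nth \<epsilon> (g' j)" if "\<epsilon> \<in> vertices m" for \<epsilon>
  proof -
    have "map (\<lambda>j. ext_nth \<epsilon> (g j)) [0..<n] = map (\<lambda>j. ext_nth \<epsilon> (g' j)) [0..<n]"
      using assms that by (auto simp: is_hat_def)
    then show ?thesis using j by auto
  qed
  have F: "ext_nth (replicate m b) (g j) = ext_nth (replicate m b) (g' j)" for b
    by (rule eq) (simp add: vertices_def)
  have G: "ext_nth ((replicate m False)[i := True]) (g j) = ext_nth ((replicate m False)[i := True]) (g' j)" for i
    by (rule eq) (simp add: vertices_def)
  have mem: "g j \<in> {NegInf, PosInf} \<union> Ix ` {..<m}" "g' j \<in> {NegInf, PosInf} \<union> Ix ` {..<m}"
    using assms j by (auto simp: is_hat_def)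
  show "g j = g' j"
  proof (cases "g j"; cases "g' j")
    fix i i' assume *: "g j = Ix i" "g' j = Ix i'"
    then have "i < m" "i' < m" using mem by auto
    with * show ?thesis using G[of i] by (auto simp: nth_list_update split: if_splits)
  qed (use mem F[of True] F[of False] in auto)
qed

lemma is_hatI:
  assumes "\<And>j. j < n \<Longrightarrow> g j \<in> {NegInf, PosInf} \<union> Ix ` {..<m}"
    "\<And>\<epsilon>. \<epsilon> \<in> vertices m \<Longrightarrow> f \<epsilon> \<in> vertices n"
    "\<And>\<epsilon> j. \<epsilon> \<in> vertices m \<Longrightarrow> j < n \<Longrightarrow> f \<epsilon> ! j = ext_nth \<epsilon> (g j)"
  shows "is_hat m n f (restrict g {..<n})"
  unfolding is_hat_def
proof
  show "restrict g {..<n} \<in> {..<n} \<rightarrow>\<^sub>E {NegInf, PosInf} \<union> Ix ` {..<m}"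
    using assms(1) by (intro restrict_PiE_iff[THEN iffD2] ballI) auto
  show "\<forall>\<epsilon>\<in>vertices m. f \<epsilon> = map (\<lambda>j. ext_nth \<epsilon> (restrict g {..<n} j)) [0..<n]"
  proof
    fix \<epsilon> assume e: "\<epsilon> \<in> vertices m"
    have "length (f \<epsilon>) = n" using assms(2)[OF e] by (simp add: vertices_def)
    then show "f \<epsilon> = map (\<lambda>j. ext_nth \<epsilon> (restrict g {..<n} j)) [0..<n]"
      using assms(3)[OF e] by (simp add: list_eq_iff_nth_eq)
  qed
qed

lemma box_hom_hat_aux:
  "box_hom m n f \<Longrightarrow> \<exists>g. is_hat m n f g \<and> (\<forall>i<m. \<exists>!j. j < n \<and> g j = Ix i)"
proof (induction rule: box_hom.induct)
  case (ident n)
  show ?case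
  proof (intro exI conjI)
    show "is_hat n n (restrict id (vertices n)) (restrict Ix {..<n})"
      by (rule is_hatI) auto
  qed auto
next
  case (face i n \<alpha>)
  let ?g = "restrict (\<lambda>j. if j < i then Ix j else if j = i then (if \<alpha> then PosInf else NegInf)
     else Ix (j - 1)) {..<Suc n}"
  have 1: "is_hat n (Suc n) (Defs.face n i \<alpha>) ?g"
    using face by (intro is_hatI) (auto simp: vertices_def face_def nth_append nth_Cons')
  have 2: "\<exists>!j. j < Suc n \<and> ?g j = Ix k" if "k < n" for k
    using that face by (intro ex1I[of _ "if k < i then k else Suc k"]) (auto split: if_splits)
  show ?case using 1 2 by blast
next
  case (symm i n)
  let ?s = "\<lambda>j. if j = i then Suc i else if j = Suc i then i else j"
  let ?g = "restrict (\<lambda>j. Ix (?s j)) {..<n}"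
  have 1: "is_hat n n (Defs.symm n i) ?g"
    using symm by (intro is_hatI) (auto simp: vertices_def symm_def nth_list_update)
  have 2: "\<exists>!j. j < n \<and> ?g j = Ix k" if "k < n" for k
    using that symm by (intro ex1I[of _ "?s k"]) (auto split: if_splits)
  show ?case using 1 2 by blast
next
  case (comp l m f n g)
  then obtain a b where a: "is_hat l m f a" "\<forall>i<l. \<exists>!j. j < m \<and> a j = Ix i"
    and b: "is_hat m n g b" "\<forall>i<m. \<exists>!j. j < n \<and> b j = Ix i" by auto
  let ?c = "restrict (\<lambda>j. case b j of Ix k \<Rightarrow> a k | e \<Rightarrow> e) {..<n}"
  have bm: "b j \<in> {NegInf, PosInf} \<union> Ix ` {..<m}" if "j < n" for j
    using b(1) that by (auto simp: is_hat_def)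
  have am: "a j \<in> {NegInf, PosInf} \<union> Ix ` {..<l}" if "j < m" for j
    using a(1) that by (auto simp: is_hat_def)
  have 1: "is_hat l n (compose (vertices l) g f) ?c"
    unfolding is_hat_def
  proof
    show "?c \<in> {..<n} \<rightarrow>\<^sub>E {NegInf, PosInf} \<union> Ix ` {..<l}"
    proof (rule restrict_PiE_iff[THEN iffD2], rule ballI)
      fix j assume "j \<in> {..<n}"
      then show "(case b j of Ix k \<Rightarrow> a k | e \<Rightarrow> e) \<in> {NegInf, PosInf} \<union> Ix ` {..<l}"
        using bm[of j] am by (cases "b j") auto
    qed
    show "\<forall>\<epsilon>\<in>vertices l. compose (vertices l) g f \<epsilon> = map (\<lambda>j. ext_nth \<epsilon> (?c j)) [0..<n]"
    proof
      fix \<epsilon> assume e: "\<epsilon> \<in> vertices l"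
      then have "f \<epsilon> \<in> vertices m" using comp box_hom_vertices by blast
      then have "g (f \<epsilon>) = map (\<lambda>j. ext_nth (f \<epsilon>) (b j)) [0..<n]"
        using b(1) by (auto simp: is_hat_def)
      moreover have "ext_nth (f \<epsilon>) (b j) = ext_nth \<epsilon> (?c j)" if "j < n" for j
      proof (cases "b j")
        case (Ix k)
        then have "k < m" using bm[OF that] by auto
        with a(1) e have "f \<epsilon> ! k = ext_nth \<epsilon> (a k)" by (auto simp: is_hat_def)
        then show ?thesis using Ix that by simp
      qed (use that in auto)
      ultimately show "compose (vertices l) g f \<epsilon> = map (\<lambda>j. ext_nth \<epsilon> (?c j)) [0..<n]"
        using e by (simp add: compose_eq)
    qed
  qed
  have 2: "\<exists>!j. j < n \<and> ?c j = Ix i" if i: "i < l" for i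
  proof -
    obtain k where k: "k < m" "a k = Ix i" using a(2) i by blast
    obtain j where j: "j < n" "b j = Ix k" using b(2) k by blast
    show ?thesis
    proof (rule ex1I[of _ j])
      show "j < n \<and> ?c j = Ix i" using j k by simp
      fix j' assume j': "j' < n \<and> ?c j' = Ix i"
      then obtain k' where k': "b j' = Ix k'" "a k' = Ix i" by (cases "b j'") auto
      then have "k' < m" using bm[of j'] j' by auto
      then have "k' = k" using a(2) i k k' by blast
      then show "j' = j" using b(2) k(1) j j' k' by blast
    qed
  qed
  show ?case using 1 2 by blast
qed

lemma hat_exists1: "box_hom m n f \<Longrightarrow> \<exists>!g. is_hat m n f g"
  using box_hom_hat_aux is_hat_unique by blast

lemma is_hat_hat: "box_hom m n f \<Longrightarrow> is_hat m n f (hat m n f)"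
  unfolding hat_def by (rule theI'[OF hat_exists1])

lemma hat_preimage_exists1: "box_hom m n f \<Longrightarrow> i < m \<Longrightarrow> \<exists>!j. j < n \<and> hat m n f j = Ix i"
  using box_hom_hat_aux is_hat_unique is_hat_hat by metis

lemma hat_preimage:
  assumes "box_hom m n f" "i < m"
  shows "hat_preimage m n f i < n" "hat m n f (hat_preimage m n f i) = Ix i"
  using theI'[OF hat_preimage_exists1[OF assms]] by (auto simp: hat_preimage_def)

lemma hat_preimage_eqI:
  assumes "box_hom m n f" "i < m" "j < n" "\<And>\<epsilon>. \<epsilon> \<in> vertices m \<Longrightarrow> f \<epsilon> ! j = \<epsilon> ! i"
  shows "hat_preimage m n f i = j"
proof -
  let ?h = "hat m n f j"
  have h: "ext_nth \<epsilon> ?h = \<epsilon> ! i" if "\<epsilon> \<in> vertices m" for \<epsilon>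
    using is_hat_hat[OF assms(1)] that assms(3) assms(4)[OF that] by (auto simp: is_hat_def)
  have mem: "?h \<in> {NegInf, PosInf} \<union> Ix ` {..<m}"
    using is_hat_hat[OF assms(1)] assms(3) by (auto simp: is_hat_def)
  have "?h = Ix i"
  proof (cases ?h)
    case NegInf
    then show ?thesis using h[of "replicate m True"] assms(2) by (simp add: vertices_def)
  next
    case PosInf
    then show ?thesis using h[of "replicate m False"] assms(2) by (simp add: vertices_def)
  next
    case (Ix k)
    then have "k < m" using mem by auto
    then show ?thesis
      using h[of "(replicate m False)[i := True]"] assms(2) Ix
      by (auto simp: vertices_def nth_list_update split: if_splits)
  qed
  then show ?thesis
    using hat_preimage_exists1[OF assms(1,2)] hat_preimage[OF assms(1,2)] assms(3) by blast
qed

lemma nth_hat_preimage: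
  assumes "box_hom m n f" "i < m" "\<epsilon> \<in> vertices m"
  shows "f \<epsilon> ! hat_preimage m n f i = \<epsilon> ! i"
  using is_hat_hat[OF assms(1)] hat_preimage[OF assms(1,2)] assms(3) by (auto simp: is_hat_def)

lemma hat_preimage_inj:
  assumes "box_hom m n f" "i < m" "i' < m" "hat_preimage m n f i = hat_preimage m n f i'"
  shows "i = i'"
  by (metis hat_preimage(2)[OF assms(1,2)] hat_preimage(2)[OF assms(1,3)] assms(4) ext_index.inject)

lemma nth_not_hat_preimage:
  assumes "box_hom m n f" "j < n" "j \<notin> hat_preimage m n f ` {..<m}"
    "\<epsilon> \<in> vertices m" "\<epsilon>' \<in> vertices m"
  shows "f \<epsilon> ! j = f \<epsilon>' ! j"
proof -
  have mem: "hat m n f j \<in> {NegInf, PosInf} \<union> Ix ` {..<m}"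
    using is_hat_hat[OF assms(1)] assms(2) by (auto simp: is_hat_def)
  have no: "hat m n f j \<noteq> Ix i" if "i < m" for i
    using hat_preimage_exists1[OF assms(1) that] hat_preimage[OF assms(1) that] assms(2,3) that
    by blast
  have "f \<epsilon> ! j = ext_nth \<epsilon> (hat m n f j)" "f \<epsilon>' ! j = ext_nth \<epsilon>' (hat m n f j)"
    using is_hat_hat[OF assms(1)] assms by (auto simp: is_hat_def)
  then show ?thesis using mem no by auto
qed

lemma hat_preimage_ident: "i < n \<Longrightarrow> hat_preimage n n (restrict id (vertices n)) i = i"
  by (rule hat_preimage_eqI[OF box_hom.ident]) simp_all

lemma hat_preimage_comp:
  assumes "box_hom l m f" "box_hom m n g" "i < l"
  shows "hat_preimage l n (compose (vertices l) g f) i = hat_preimage m n g (hat_preimage l m f i)"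
  using assms
  by (intro hat_preimage_eqI box_hom.comp[OF assms(1,2)])
     (auto simp: compose_eq hat_preimage nth_hat_preimage box_hom_vertices[OF assms(1)])

lemma pull_bang_face:
  assumes "i \<le> n" "length w = Suc n"
  shows "pull bang n (Suc n) (face n i \<alpha>) w = take i w @ drop (Suc i) w"
proof -
  have "hat_preimage n (Suc n) (face n i \<alpha>) k = (if k < i then k else Suc k)" if "k < n" for k
    using assms that
    by (intro hat_preimage_eqI box_hom.face)
       (auto simp: face_def vertices_def nth_append nth_Cons')
  then show ?thesis
    using assms by (auto simp: bang_def nth_append min_def intro!: nth_equalityI)
qed

lemma pull_bang_symm:
  assumes "Suc i < n" "length w = n"
  shows "pull bang n n (symm n i) w = w[i := w ! Suc i, Suc i := w ! i]"
proof -
  have "hat_preimage n n (symm n i) k = (if k = i then Suc i else if k = Suc i then i else k)"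
    if "k < n" for k
    using assms that
    by (intro hat_preimage_eqI box_hom.symm) (auto simp: symm_def vertices_def nth_list_update)
  then show ?thesis
    using assms by (auto simp: bang_def nth_list_update intro!: nth_equalityI)
qed

lemma sym_precubical_bang: "sym_precubical bang"
  by (auto simp: sym_precubical_def bang_def hat_preimage_ident hat_preimage_comp hat_preimage
      intro!: nth_equalityI)

lemma sym_precubical_std_cube: "sym_precubical (std_cube p)"
proof -
  have id: "compose (vertices n) x (restrict id (vertices n)) = x" if "box_hom n p x" for n x
    using box_hom_extensional[OF that] by (auto simp: fun_eq_iff compose_def extensional_def)
  have assoc: "compose (vertices l) x (compose (vertices l) g f) =
      compose (vertices l) (compose (vertices m) x g) f" if "box_hom l m f" for l m f g x
    using box_hom_vertices[OF that] by (auto simp: fun_eq_iff compose_def)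
  show ?thesis
    unfolding sym_precubical_def std_cube_def presheaf.simps mem_Collect_eq Ball_def
    using box_hom.comp id assoc by blast
qed

lemma sym_precubical_boundary: "sym_precubical (boundary p)"
proof -
  have "k < p" if "box_hom k n f" "n < p" for k n f
    using box_hom_le[OF that(1)] that(2) by simp
  then show ?thesis
    using sym_precubical_std_cube[of p] 
    unfolding sym_precubical_def boundary_def by (simp add: Ball_def) blast
qed

lemma cube_ts_simps [simp]:
  "states (cube_ts as) = vertices (length as)"
  "actions (cube_ts as) = {(as ! i, i) |i. i < length as}"
  "lab (cube_ts as) = fst"
  by (simp_all add: cube_ts_def)

lemma cube_trans_iff:
  "(\<epsilon>, us, \<epsilon>') \<in> trans (cube_ts as) \<longleftrightarrow>
     length \<epsilon> = length as \<and> length \<epsilon>' = length as \<and> us \<noteq> [] \<and>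
     set us \<subseteq> actions (cube_ts as) \<and> distinct (map snd us) \<and>
     (\<forall>i < length as. \<epsilon> ! i \<le> \<epsilon>' ! i \<and> (\<epsilon> ! i \<noteq> \<epsilon>' ! i \<longleftrightarrow> i \<in> snd ` set us))"
  by (auto simp: cube_ts_def vertices_def Suc_le_eq)

lemma whdts_cube: "whdts (cube_ts as)"
proof -
  have "multiset_axiom (trans (cube_ts as))"
    unfolding multiset_axiom_def cube_trans_iff
  proof (intro allI impI)
    fix \<alpha> \<beta> :: "bool list" and us :: "('a \<times> nat) list" and \<sigma>
    assume len: "2 \<le> length us" and \<sigma>: "\<sigma> permutes {..<length us}"
      and h: "length \<alpha> = length as \<and> length \<beta> = length as \<and> us \<noteq> [] \<and>
        set us \<subseteq> actions (cube_ts as) \<and> distinct (map snd us) \<and>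
        (\<forall>i<length as. \<alpha> ! i \<le> \<beta> ! i \<and> (\<alpha> ! i \<noteq> \<beta> ! i \<longleftrightarrow> i \<in> snd ` set us))"
    have "distinct (map snd (permute_list \<sigma> us))"
      using h \<sigma> by (simp only: permute_list_map[OF \<sigma>, symmetric]) (simp del: length_map add: length_map)
    moreover have "permute_list \<sigma> us \<noteq> []"
      using len length_permute_list[of \<sigma> us] by force
    ultimately show "length \<alpha> = length as \<and> length \<beta> = length as \<and> permute_list \<sigma> us \<noteq> [] \<and>
        set (permute_list \<sigma> us) \<subseteq> actions (cube_ts as) \<and> distinct (map snd (permute_list \<sigma> us)) \<and>
        (\<forall>i<length as. \<alpha> ! i \<le> \<beta> ! i \<and> (\<alpha> ! i \<noteq> \<beta> ! i \<longleftrightarrow> i \<in> snd ` set (permute_list \<sigma> us)))"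
      using h set_permute_list[OF \<sigma>] by simp
  qed
  moreover have "coherence_axiom (trans (cube_ts as))"
    unfolding coherence_axiom_def
  proof (intro allI impI)
    fix \<alpha> \<beta> \<nu>1 \<nu>2 :: "bool list" and us :: "('a \<times> nat) list" and p q :: nat
    assume p: "1 \<le> p" and q: "1 \<le> q" and pq: "p + q < length us"
      and 0: "(\<alpha>, us, \<beta>) \<in> trans (cube_ts as)"
      and 1: "(\<alpha>, take p us, \<nu>1) \<in> trans (cube_ts as)"
      and 2: "(\<alpha>, take (p + q) us, \<nu>2) \<in> trans (cube_ts as)"
    define mid where "mid = take q (drop p us)"
    have split: "take (p + q) us = take p us @ mid" unfolding mid_def by (rule take_add)
    have dist: "distinct (map snd (take p us @ mid))"
      using 2 by (simp only: cube_trans_iff split)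
    have sub: "set mid \<subseteq> actions (cube_ts as)"
      using 2 unfolding cube_trans_iff split by auto
    have ne: "mid \<noteq> []" using q pq by (simp add: mid_def)
    have disj: "snd ` set (take p us) \<inter> snd ` set mid = {}" using dist by auto
    have "\<nu>1 ! i \<le> \<nu>2 ! i \<and> (\<nu>1 ! i \<noteq> \<nu>2 ! i \<longleftrightarrow> i \<in> snd ` set mid)" if "i < length as" for i
    proof -
      have a: "\<alpha> ! i \<le> \<nu>1 ! i" "\<alpha> ! i \<noteq> \<nu>1 ! i \<longleftrightarrow> i \<in> snd ` set (take p us)"
        using 1 that by (auto simp only: cube_trans_iff)
      have b: "\<alpha> ! i \<le> \<nu>2 ! i"
        "\<alpha> ! i \<noteq> \<nu>2 ! i \<longleftrightarrow> i \<in> snd ` set (take p us) \<or> i \<in> snd ` set mid"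
        using 2 that by (auto simp only: cube_trans_iff split set_append image_Un Un_iff)
      show ?thesis using a b disj by (cases "\<alpha> ! i"; cases "\<nu>1 ! i"; cases "\<nu>2 ! i") auto
    qed
    then show "(\<nu>1, take q (drop p us), \<nu>2) \<in> trans (cube_ts as)"
      using 1 2 dist sub ne unfolding mid_def[symmetric] cube_trans_iff by simp
  qed
  moreover have "\<forall>(\<alpha>, us, \<beta>) \<in> trans (cube_ts as). length us \<ge> 1 \<and>
      \<alpha> \<in> states (cube_ts as) \<and> set us \<subseteq> actions (cube_ts as) \<and> \<beta> \<in> states (cube_ts as)"
    by (auto simp: cube_ts_def)
  ultimately show ?thesis unfolding whdts_def by blast
qed

lemma cube_map_hom:
  assumes f: "box_hom m n f" and bs: "length bs = n"
  shows "whdts_hom (cube_ts (pull bang m n f bs)) (cube_ts bs) f (cube_map_action m n f)"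
proof -
  let ?as = "pull bang m n f bs" and ?t = "hat_preimage m n f"
  have len: "length ?as = m" by (simp add: bang_def)
  have nth: "?as ! i = bs ! ?t i" if "i < m" for i using that by (simp add: bang_def)
  have act: "cube_map_action m n f u \<in> actions (cube_ts bs) \<and>
      lab (cube_ts bs) (cube_map_action m n f u) = lab (cube_ts ?as) u"
    if "u \<in> actions (cube_ts ?as)" for u
    using that len nth hat_preimage(1)[OF f] bs by (auto simp: cube_map_action_def)
  have "(f \<alpha>, map (cube_map_action m n f) us, f \<beta>) \<in> trans (cube_ts bs)"
    if t: "(\<alpha>, us, \<beta>) \<in> trans (cube_ts ?as)" for \<alpha> us \<beta>
  proof -
    have ab: "\<alpha> \<in> vertices m" "\<beta> \<in> vertices m"
      using t by (auto simp: cube_trans_iff len vertices_def)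
    have us: "snd ` set us \<subseteq> {..<m}" "set us \<subseteq> actions (cube_ts ?as)"
      using t by (auto simp: cube_trans_iff len)
    have snd_map: "map snd (map (cube_map_action m n f) us) = map ?t (map snd us)"
      by (simp add: cube_map_action_def)
    have inj: "inj_on ?t {..<m}" using hat_preimage_inj[OF f] by (auto simp: inj_on_def)
    have snd_set: "snd ` set (map (cube_map_action m n f) us) = ?t ` snd ` set us"
      by (auto simp: cube_map_action_def image_image)
    have "distinct (map snd us)" using t by (simp add: cube_trans_iff)
    then have d: "distinct (map snd (map (cube_map_action m n f) us))"
      unfolding snd_map distinct_map[of ?t] using inj_on_subset[OF inj us(1)] by simp
    have "f \<alpha> ! j \<le> f \<beta> ! j \<and> (f \<alpha> ! j \<noteq> f \<beta> ! j \<longleftrightarrow> j \<in> ?t ` snd ` set us)" if j: "j < n" for j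
    proof (cases "j \<in> ?t ` {..<m}")
      case True
      then obtain i where i: "i < m" "j = ?t i" by auto
      have "f \<alpha> ! j = \<alpha> ! i" "f \<beta> ! j = \<beta> ! i" using nth_hat_preimage[OF f i(1)] ab i(2) by auto
      moreover have "j \<in> ?t ` snd ` set us \<longleftrightarrow> i \<in> snd ` set us"
        using inj us(1) i by (auto simp: inj_on_image_mem_iff)
      moreover have "\<alpha> ! i \<le> \<beta> ! i \<and> (\<alpha> ! i \<noteq> \<beta> ! i \<longleftrightarrow> i \<in> snd ` set us)"
        using t i(1) by (simp only: cube_trans_iff len)
      ultimately show ?thesis by simp
    next
      case False
      then have "j \<notin> ?t ` snd ` set us" using us(1) by blast
      then show ?thesis using nth_not_hat_preimage[OF f j False ab] by simp
    qed
    moreover have "set (map (cube_map_action m n f) us) \<subseteq> actions (cube_ts bs)"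
      using act us(2) by auto
    moreover have "length (f \<alpha>) = n" "length (f \<beta>) = n"
      using box_hom_vertices[OF f] ab by (auto simp: vertices_def)
    moreover have "us \<noteq> []" using t by (simp add: cube_trans_iff)
    ultimately show ?thesis using d bs unfolding cube_trans_iff snd_set by simp
  qed
  then show ?thesis
    using act box_hom_vertices[OF f] len bs unfolding whdts_hom_def by (auto simp del: cube_ts_simps(2,3))
qed

lemma cube_map_action_ident:
  "u \<in> actions (cube_ts as) \<Longrightarrow> length as = n \<Longrightarrow>
     cube_map_action n n (restrict id (vertices n)) u = u"
  by (auto simp: cube_map_action_def hat_preimage_ident simp del: restrict_apply)

lemma cube_map_action_comp:
  "box_hom l m f \<Longrightarrow> box_hom m n g \<Longrightarrow> u \<in> actions (cube_ts as) \<Longrightarrow> length as = l \<Longrightarrow>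
     cube_map_action l n (compose (vertices l) g f) u
       = cube_map_action m n g (cube_map_action l m f u)"
  by (auto simp: cube_map_action_def hat_preimage_comp)

lemma equiv_equiv_closure: "equiv UNIV (equiv_closure r)"
proof (rule equivI)
  show "sym (equiv_closure r)"
    unfolding equiv_closure_def by (rule sym_rtrancl) (auto simp: sym_def)
qed (auto simp: equiv_closure_def refl_rtrancl trans_rtrancl)

lemma equiv_closure_invariant:
  assumes "(s, t) \<in> equiv_closure r" "\<And>s t. (s, t) \<in> r \<Longrightarrow> v s = v t"
  shows "v s = v t"
  using assms(1) unfolding equiv_closure_def by induction (use assms(2) in force)+

definition induced :: "('b \<Rightarrow> 'c) \<Rightarrow> 'b set \<Rightarrow> 'c" where
  "induced v c = v (SOME t. t \<in> c)"

lemma induced_class: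
  assumes "\<And>s t. (s, t) \<in> r \<Longrightarrow> v s = v t"
  shows "induced v (equiv_closure r `` {t}) = v t"
proof -
  let ?s = "SOME s. s \<in> equiv_closure r `` {t}"
  have "t \<in> equiv_closure r `` {t}" by (simp add: equiv_closure_def)
  then have "?s \<in> equiv_closure r `` {t}" by (rule someI)
  then have "(t, ?s) \<in> equiv_closure r" by simp
  then have "v t = v ?s" by (rule equiv_closure_invariant) (rule assms)
  then show ?thesis by (simp add: induced_def)
qed

definition cube_cocone ::
  "'c presheaf \<Rightarrow> (nat \<Rightarrow> 'c \<Rightarrow> 'a list) \<Rightarrow> ('s, 'l, 'a) hdts \<Rightarrow>
   (nat \<Rightarrow> 'c \<Rightarrow> bool list \<Rightarrow> 's) \<Rightarrow> (nat \<Rightarrow> 'c \<Rightarrow> 'a \<times> nat \<Rightarrow> 'l) \<Rightarrow> bool" where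
  "cube_cocone K lbl Y \<phi>0 \<phi>1 \<longleftrightarrow>
     (\<forall>n. \<forall>x \<in> cubes K n. whdts_hom (cube_ts (lbl n x)) Y (\<phi>0 n x) (\<phi>1 n x)) \<and>
     (\<forall>m n f. box_hom m n f \<longrightarrow> (\<forall>x \<in> cubes K n.
        (\<forall>\<epsilon> \<in> vertices m. \<phi>0 m (pull K m n f x) \<epsilon> = \<phi>0 n x (f \<epsilon>)) \<and>
        (\<forall>u \<in> actions (cube_ts (lbl m (pull K m n f x))).
           \<phi>1 m (pull K m n f x) u = \<phi>1 n x (cube_map_action m n f u))))"

lemma labelled_length: "labelled K lbl \<Longrightarrow> x \<in> cubes K n \<Longrightarrow> length (lbl n x) = n"
  by (auto simp: labelled_def precubical_map_def bang_def)

lemma labelled_pull: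
  "labelled K lbl \<Longrightarrow> box_hom m n f \<Longrightarrow> x \<in> cubes K n \<Longrightarrow> pull K m n f x \<in> cubes K m"
  by (auto simp: labelled_def sym_precubical_def)

lemma labelled_natural:
  "labelled K lbl \<Longrightarrow> box_hom m n f \<Longrightarrow> x \<in> cubes K n \<Longrightarrow>
     lbl m (pull K m n f x) = pull bang m n f (lbl n x)"
  by (auto simp: labelled_def precubical_map_def)

lemma state_in_step:
  assumes "box_hom m n f" "x \<in> cubes K n" "\<epsilon> \<in> vertices m"
  shows "state_in K m (pull K m n f x) \<epsilon> = state_in K n x (f \<epsilon>)"
  unfolding state_in_def state_eq_def
  by (rule equiv_class_eq[OF equiv_equiv_closure])
     (unfold equiv_closure_def, rule r_into_rtrancl, use assms in blast)

lemma action_in_step: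
  assumes "box_hom m n f" "x \<in> cubes K n" "u \<in> actions (cube_ts (lbl m (pull K m n f x)))"
  shows "action_in K lbl m (pull K m n f x) u = action_in K lbl n x (cube_map_action m n f u)"
  unfolding action_in_def action_eq_def
  by (rule equiv_class_eq[OF equiv_equiv_closure])
     (unfold equiv_closure_def, rule r_into_rtrancl, use assms in blast)

lemma realization_states:
  "states (realization K lbl) = {state_in K n x \<epsilon> |n x \<epsilon>. x \<in> cubes K n \<and> \<epsilon> \<in> vertices n}"
  by (auto simp: realization_def cube_states_def quotient_def state_in_def)

lemma realization_actions:
  "actions (realization K lbl) =
     {action_in K lbl n x u |n x u. x \<in> cubes K n \<and> u \<in> actions (cube_ts (lbl n x))}"
  by (simp add: realization_def cube_actions_def quotient_def action_in_def) blast

lemma realization_lab: "lab (realization K lbl) (action_in K lbl n x u) = fst u"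
proof -
  have inv: "a = fst u" if "(n', x', a, i) \<in> action_in K lbl n x u" for n' x' a i
  proof -
    have "((n, x, u), (n', x', a, i)) \<in> action_eq K lbl" using that by (simp add: action_in_def)
    then have "fst (snd (snd (n, x, u))) = fst (snd (snd (n', x', a, i)))"
      unfolding action_eq_def
      by (rule equiv_closure_invariant) (auto simp: cube_map_action_def)
    then show ?thesis by simp
  qed
  have "(n, x, fst u, snd u) \<in> action_in K lbl n x u"
    by (simp add: action_in_def action_eq_def equiv_closure_def)
  then have "(THE a. \<exists>n' x' i. (n', x', a, i) \<in> action_in K lbl n x u) = fst u"
    using inv by (intro the_equality) blast+
  then show ?thesis by (simp add: realization_def)
qed

theorem whdts_realization:
  assumes K: "labelled K lbl"
  shows "whdts (realization K lbl)"
proof -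
  let ?X = "realization K lbl"
  have "length us \<ge> 1 \<and> \<alpha> \<in> states ?X \<and> set us \<subseteq> actions ?X \<and> \<beta> \<in> states ?X"
    if "(\<alpha>, us, \<beta>) \<in> trans ?X" for \<alpha> us \<beta>
  proof -
    have "(\<alpha>, us, \<beta>) \<in> whdts_closure
        {(state_in K n x \<alpha>, map (action_in K lbl n x) us, state_in K n x \<beta>) |n x \<alpha> us \<beta>.
           x \<in> cubes K n \<and> (\<alpha>, us, \<beta>) \<in> trans (cube_ts (lbl n x))}"
      (is "_ \<in> whdts_closure ?G") using that by (simp add: realization_def)
    then have "case (\<alpha>, us, \<beta>) of (\<alpha>, us, \<beta>) \<Rightarrow>
        length us \<ge> 1 \<and> \<alpha> \<in> states ?X \<and> set us \<subseteq> actions ?X \<and> \<beta> \<in> states ?X"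
    proof induction
      case (gen t)
      then obtain n x \<alpha> us \<beta> where t: "t = (state_in K n x \<alpha>, map (action_in K lbl n x) us, state_in K n x \<beta>)"
        "x \<in> cubes K n" "(\<alpha>, us, \<beta>) \<in> trans (cube_ts (lbl n x))" by blast
      have len: "length (lbl n x) = n" using labelled_length[OF K t(2)] .
      have "\<alpha> \<in> vertices n" "\<beta> \<in> vertices n" "us \<noteq> []" "set us \<subseteq> actions (cube_ts (lbl n x))"
        using t(3) unfolding cube_trans_iff by (auto simp: vertices_def len)
      moreover from this have "action_in K lbl n x ` set us \<subseteq> actions ?X"
        using t(2) unfolding realization_actions by blast
      moreover from calculation have "state_in K n x \<alpha> \<in> states ?X" "state_in K n x \<beta> \<in> states ?X"
        using t(2) unfolding realization_states by blast+
      ultimately show ?case by (simp add: t(1) Suc_le_eq)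
    qed (auto dest: in_set_takeD in_set_dropD)
    then show ?thesis by simp
  qed
  moreover have "multiset_axiom (trans ?X)"
    unfolding multiset_axiom_def realization_def by (auto intro: whdts_closure.mset)
  moreover have "coherence_axiom (trans ?X)"
    unfolding coherence_axiom_def realization_def hdts.simps
    by (intro allI impI) (rule whdts_closure.coh)
  ultimately show ?thesis unfolding whdts_def by blast
qed

theorem cube_cocone_realization:
  assumes K: "labelled K lbl"
  shows "cube_cocone K lbl (realization K lbl) (state_in K) (action_in K lbl)"
proof -
  have "whdts_hom (cube_ts (lbl n x)) (realization K lbl) (state_in K n x) (action_in K lbl n x)"
    if x: "x \<in> cubes K n" for n x
    unfolding whdts_hom_def
  proof (intro conjI ballI)
    show "state_in K n x s \<in> states (realization K lbl)" if "s \<in> states (cube_ts (lbl n x))" for s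
      using that x labelled_length[OF K x] unfolding realization_states by auto
    show "action_in K lbl n x u \<in> actions (realization K lbl)"
      "lab (realization K lbl) (action_in K lbl n x u) = lab (cube_ts (lbl n x)) u"
      if "u \<in> actions (cube_ts (lbl n x))" for u
      using that x unfolding realization_lab realization_actions by (blast, simp)
    show "case t of (\<alpha>, us, \<beta>) \<Rightarrow>
        (state_in K n x \<alpha>, map (action_in K lbl n x) us, state_in K n x \<beta>) \<in> trans (realization K lbl)"
      if "t \<in> trans (cube_ts (lbl n x))" for t
    proof -
      obtain \<alpha> us \<beta> where t: "t = (\<alpha>, us, \<beta>)" by (cases t)
      show ?thesis
        unfolding t prod.case realization_def hdts.simps
        by (rule whdts_closure.gen) (use that x t in blast)
    qed
  qed
  then show ?thesis
    unfolding cube_cocone_def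
    by (intro conjI allI impI ballI) (assumption | rule state_in_step action_in_step | simp)+
qed

theorem realization_universal:
  assumes K: "labelled K lbl" and Y: "whdts Y" and \<phi>: "cube_cocone K lbl Y \<phi>0 \<phi>1"
  shows "\<exists>h0 h1. whdts_hom (realization K lbl) Y h0 h1 \<and>
    (\<forall>n. \<forall>x \<in> cubes K n.
       (\<forall>\<epsilon> \<in> vertices n. h0 (state_in K n x \<epsilon>) = \<phi>0 n x \<epsilon>) \<and>
       (\<forall>u \<in> actions (cube_ts (lbl n x)). h1 (action_in K lbl n x u) = \<phi>1 n x u))"
proof -
  let ?X = "realization K lbl"
  define h0 where "h0 = induced (\<lambda>(n, x, \<epsilon>). \<phi>0 n x \<epsilon>)"
  define h1 where "h1 = induced (\<lambda>(n, x, u). \<phi>1 n x u)"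
  have h0: "h0 (state_in K n x \<epsilon>) = \<phi>0 n x \<epsilon>" for n x \<epsilon>
    unfolding h0_def state_in_def state_eq_def
    by (subst induced_class) (use \<phi> in \<open>auto simp: cube_cocone_def\<close>)
  have h1: "h1 (action_in K lbl n x u) = \<phi>1 n x u" for n x u
    unfolding h1_def action_in_def action_eq_def
    by (subst induced_class) (use \<phi> in \<open>auto simp: cube_cocone_def simp del: cube_ts_simps\<close>)
  have hom: "whdts_hom (cube_ts (lbl n x)) Y (\<phi>0 n x) (\<phi>1 n x)" if "x \<in> cubes K n" for n x
    using \<phi> that by (simp add: cube_cocone_def)
  have "whdts_hom ?X Y h0 h1"
    unfolding whdts_hom_def
  proof (intro conjI ballI)
    fix s assume "s \<in> states ?X"
    then obtain n x \<epsilon> where s: "s = state_in K n x \<epsilon>" "x \<in> cubes K n" "\<epsilon> \<in> vertices n"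
      unfolding realization_states by blast
    then show "h0 s \<in> states Y"
      using hom[OF s(2)] labelled_length[OF K s(2)] by (simp add: h0 whdts_hom_def)
  next
    fix u assume "u \<in> actions ?X"
    then obtain n x v where u: "u = action_in K lbl n x v" "x \<in> cubes K n"
      "v \<in> actions (cube_ts (lbl n x))" unfolding realization_actions by blast
    then have "\<phi>1 n x v \<in> actions Y \<and> lab Y (\<phi>1 n x v) = lab (cube_ts (lbl n x)) v"
      using hom[OF u(2)] unfolding whdts_hom_def by blast
    then show "h1 u \<in> actions Y" "lab Y (h1 u) = lab ?X u"
      by (simp_all add: u(1) h1 realization_lab)
  next
    fix t assume "t \<in> trans ?X"
    then have "t \<in> whdts_closure
        {(state_in K n x \<alpha>, map (action_in K lbl n x) us, state_in K n x \<beta>) |n x \<alpha> us \<beta>.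
           x \<in> cubes K n \<and> (\<alpha>, us, \<beta>) \<in> trans (cube_ts (lbl n x))}"
      by (simp add: realization_def)
    then show "case t of (\<alpha>, us, \<beta>) \<Rightarrow> (h0 \<alpha>, map h1 us, h0 \<beta>) \<in> trans Y"
    proof induction
      case (gen t)
      then obtain n x \<alpha> us \<beta> where t:
        "t = (state_in K n x \<alpha>, map (action_in K lbl n x) us, state_in K n x \<beta>)"
        "x \<in> cubes K n" "(\<alpha>, us, \<beta>) \<in> trans (cube_ts (lbl n x))" by blast
      then have "(\<phi>0 n x \<alpha>, map (\<phi>1 n x) us, \<phi>0 n x \<beta>) \<in> trans Y"
        using hom[OF t(2)] unfolding whdts_hom_def by blast
      then show ?case by (simp add: t(1) h0 h1 o_def)
    next
      case (mset us \<sigma> \<alpha> \<beta>)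
      then have "(h0 \<alpha>, permute_list \<sigma> (map h1 us), h0 \<beta>) \<in> trans Y"
        using Y unfolding whdts_def multiset_axiom_def by simp
      then show ?case using mset(2) by (simp add: permute_list_map)
    next
      case (coh us p q \<alpha> \<beta> \<nu>1 \<nu>2)
      have "coherence_axiom (trans Y)" using Y by (simp add: whdts_def)
      from this[unfolded coherence_axiom_def, rule_format, of "map h1 us" p q "h0 \<alpha>" "h0 \<beta>" "h0 \<nu>1" "h0 \<nu>2"]
      show ?case using coh by (simp add: take_map drop_map)
    qed
  qed
  then show ?thesis using h0 h1 by blast
qed

theorem realization_universal_unique:
  assumes "\<And>n x \<epsilon>. x \<in> cubes K n \<Longrightarrow> \<epsilon> \<in> vertices n \<Longrightarrow>
      h0 (state_in K n x \<epsilon>) = h0' (state_in K n x \<epsilon>)"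
    and "\<And>n x u. x \<in> cubes K n \<Longrightarrow> u \<in> actions (cube_ts (lbl n x)) \<Longrightarrow>
      h1 (action_in K lbl n x u) = h1' (action_in K lbl n x u)"
  shows "\<forall>s \<in> states (realization K lbl). h0 s = h0' s"
    and "\<forall>u \<in> actions (realization K lbl). h1 u = h1' u"
  using assms unfolding realization_states realization_actions by blast+

text \<open>The effect of the functor on a morphism \<open>k\<close> of labelled symmetric precubical sets is given by
  the universal property, applied to the following cocone.\<close>

theorem cube_cocone_map:
  assumes K: "labelled K lbl" and K': "labelled K' lbl'" and k: "precubical_map K K' k"
    and lbl: "\<And>n x. x \<in> cubes K n \<Longrightarrow> lbl' n (k n x) = lbl n x"
  shows "cube_cocone K lbl (realization K' lbl')
    (\<lambda>n x. state_in K' n (k n x)) (\<lambda>n x. action_in K' lbl' n (k n x))"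
proof -
  note c = cube_cocone_realization[OF K', unfolded cube_cocone_def]
  have k': "k n x \<in> cubes K' n" if "x \<in> cubes K n" for n x
    using k that by (simp add: precubical_map_def)
  have nat: "k m (pull K m n f x) = pull K' m n f (k n x)" if "box_hom m n f" "x \<in> cubes K n" for m n f x
    using k that by (simp add: precubical_map_def)
  show ?thesis
    unfolding cube_cocone_def
  proof (intro conjI allI ballI impI)
    show "whdts_hom (cube_ts (lbl n x)) (realization K' lbl') (state_in K' n (k n x))
        (action_in K' lbl' n (k n x))" if "x \<in> cubes K n" for n x
      using c k'[OF that] lbl[OF that] by metis
    fix m n f x assume f: "box_hom m n f" and x: "x \<in> cubes K n"
    show "state_in K' m (k m (pull K m n f x)) \<epsilon> = state_in K' n (k n x) (f \<epsilon>)"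
      if "\<epsilon> \<in> vertices m" for \<epsilon>
      using state_in_step[OF f k'[OF x] that] nat[OF f x] by simp
    show "action_in K' lbl' m (k m (pull K m n f x)) u
        = action_in K' lbl' n (k n x) (cube_map_action m n f u)"
      if "u \<in> actions (cube_ts (lbl m (pull K m n f x)))" for u
      using action_in_step[OF f k'[OF x], of u lbl'] that nat[OF f x]
        lbl[OF labelled_pull[OF K f x]] by simp
  qed
qed

lemma labelled_std_cube:
  assumes "length as = n"
  shows "labelled (std_cube n) (\<lambda>k g. pull bang k n g as)"
  unfolding labelled_def
proof
  show "precubical_map (std_cube n) bang (\<lambda>k g. pull bang k n g as)"
    using assms
    by (auto simp: precubical_map_def std_cube_def bang_def hat_preimage_comp hat_preimage)
qed (rule sym_precubical_std_cube)

theorem realization_std_cube: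
  fixes as :: "'a list"
  defines "n \<equiv> length as"
  defines "K \<equiv> std_cube n" and "lbl \<equiv> (\<lambda>k g. pull bang k n g as)"
  defines "e \<equiv> restrict id (vertices n)"
  shows "whdts_hom (cube_ts as) (realization K lbl) (state_in K n e) (action_in K lbl n e)"
    and "\<exists>h0 h1. whdts_hom (realization K lbl) (cube_ts as) h0 h1 \<and>
      (\<forall>\<epsilon> \<in> states (cube_ts as). h0 (state_in K n e \<epsilon>) = \<epsilon>) \<and>
      (\<forall>u \<in> actions (cube_ts as). h1 (action_in K lbl n e u) = u) \<and>
      (\<forall>s \<in> states (realization K lbl). state_in K n e (h0 s) = s) \<and>
      (\<forall>u \<in> actions (realization K lbl). action_in K lbl n e (h1 u) = u)"
proof -
  have len: "length as = n" by (simp add: n_def)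
  have K: "labelled K lbl" unfolding K_def lbl_def by (rule labelled_std_cube) (rule len)
  have e: "box_hom n n e" unfolding e_def by (rule box_hom.ident)
  have eK: "e \<in> cubes K n" using e by (simp add: K_def std_cube_def)
  have lbl_e: "lbl n e = as"
    using sym_precubical_bang len unfolding lbl_def e_def
    by (auto simp: sym_precubical_def bang_def)
  have pull_e: "pull K k n g e = g" if "box_hom k n g" for k g
    using box_hom_extensional[OF that] box_hom_vertices[OF that]
    by (auto simp: K_def std_cube_def e_def fun_eq_iff compose_def extensional_def)
  have inK: "box_hom k n g" if "g \<in> cubes K k" for k g using that by (simp add: K_def std_cube_def)
  note c = cube_cocone_realization[OF K]
  show "whdts_hom (cube_ts as) (realization K lbl) (state_in K n e) (action_in K lbl n e)"
    using c eK lbl_e unfolding cube_cocone_def by metis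
  have "cube_cocone K lbl (cube_ts as) (\<lambda>k g. g) (\<lambda>k g. cube_map_action k n g)"
    unfolding cube_cocone_def
  proof (intro conjI allI ballI impI)
    show "whdts_hom (cube_ts (lbl k g)) (cube_ts as) g (cube_map_action k n g)"
      if "g \<in> cubes K k" for k g
      unfolding lbl_def by (rule cube_map_hom[OF inK[OF that] len])
    fix l m f x assume f: "box_hom l m f" and x: "x \<in> cubes K m"
    have p: "pull K l m f x = compose (vertices l) x f" by (simp add: K_def std_cube_def)
    show "pull K l m f x \<epsilon> = x (f \<epsilon>)" if "\<epsilon> \<in> vertices l" for \<epsilon>
      using that by (simp add: p compose_eq)
    show "cube_map_action l n (pull K l m f x) u = cube_map_action m n x (cube_map_action l m f u)"
      if "u \<in> actions (cube_ts (lbl l (pull K l m f x)))" for u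
      unfolding p
      by (rule cube_map_action_comp[OF f inK[OF x] that])
         (rule labelled_length[OF K labelled_pull[OF K f x]])
  qed
  from realization_universal[OF K whdts_cube this]
  obtain h0 h1 where h: "whdts_hom (realization K lbl) (cube_ts as) h0 h1"
    and h0: "\<And>k g \<epsilon>. g \<in> cubes K k \<Longrightarrow> \<epsilon> \<in> vertices k \<Longrightarrow> h0 (state_in K k g \<epsilon>) = g \<epsilon>"
    and h1: "\<And>k g u. g \<in> cubes K k \<Longrightarrow> u \<in> actions (cube_ts (lbl k g)) \<Longrightarrow>
      h1 (action_in K lbl k g u) = cube_map_action k n g u"
    by blast
  have "h0 (state_in K n e \<epsilon>) = \<epsilon>" if "\<epsilon> \<in> states (cube_ts as)" for \<epsilon>
    using that h0[OF eK] len by (simp add: e_def)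
  moreover have "h1 (action_in K lbl n e u) = u" if "u \<in> actions (cube_ts as)" for u
    using that h1[OF eK] lbl_e cube_map_action_ident[OF that len] unfolding e_def by metis
  moreover have "state_in K n e (h0 s) = s" if s: "s \<in> states (realization K lbl)" for s
  proof -
    obtain k g \<epsilon> where s: "s = state_in K k g \<epsilon>" "g \<in> cubes K k" "\<epsilon> \<in> vertices k"
      using s unfolding realization_states by blast
    then show ?thesis
      using state_in_step[OF inK[OF s(2)] eK s(3)] pull_e[OF inK[OF s(2)]] h0[OF s(2,3)] by metis
  qed
  moreover have "action_in K lbl n e (h1 u) = u" if u: "u \<in> actions (realization K lbl)" for u
  proof -
    obtain k g v where u: "u = action_in K lbl k g v" "g \<in> cubes K k"
      "v \<in> actions (cube_ts (lbl k g))"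
      using u unfolding realization_actions by blast
    then show ?thesis
      using action_in_step[OF inK[OF u(2)] eK, of v lbl] pull_e[OF inK[OF u(2)]] h1[OF u(2,3)] by metis
  qed
  ultimately show "\<exists>h0 h1. whdts_hom (realization K lbl) (cube_ts as) h0 h1 \<and>
      (\<forall>\<epsilon> \<in> states (cube_ts as). h0 (state_in K n e \<epsilon>) = \<epsilon>) \<and>
      (\<forall>u \<in> actions (cube_ts as). h1 (action_in K lbl n e u) = u) \<and>
      (\<forall>s \<in> states (realization K lbl). state_in K n e (h0 s) = s) \<and>
      (\<forall>u \<in> actions (realization K lbl). action_in K lbl n e (h1 u) = u)"
    using h by blast
qed

end

theory Submission
  imports Defs "HOL-Library.Countable" "HOL-Library.Nat_Bijection"
begin

text \<open>
  The HDA paradigm only compares cubes having the same boundary, whereas the intermediate states of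
  a transition depend on which actions are identified in the realization.  The example exploits this
  gap in the most extreme way.  Let \<open>K\<close> be the codiscrete symmetric precubical set on two points: an
  \<open>n\<close>-cube is an arbitrary map \<open>{0,1}\<^sup>n \<rightarrow> bool\<close>, restriction is precomposition, and every edge carries
  the same letter.

  A cube of \<open>K\<close> is determined by its vertices, and for \<open>p \<ge> 2\<close> the vertices of the standard cube lie in
  its boundary; so a lift is determined by the boundary, which is the HDA paradigm
  (\<open>codiscrete_HDA_paradigm\<close>).

  On the other hand any two edges of \<open>K\<close> are opposite sides of some square, hence all edges
  become one action \<open>U\<close> (\<open>codiscrete_one_action\<close>), while the two points remain distinct states
  (\<open>codiscrete_states_distinct\<close>).  As any two states are joined by an edge and are the extreme
  corners of a square, \<open>(s, U, t)\<close> and \<open>(s, U, U, t)\<close> are transitions for all states \<open>s\<close>, \<open>t\<close>.  Thus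
  both states are intermediate states of every 2-transition \<open>(s, U, U, t)\<close>.
\<close>

section \<open>The codiscrete symmetric precubical set on two points\<close>

text \<open>
  A map \<open>{0,1}\<^sup>n \<rightarrow> bool\<close> is coded by the natural number whose binary digits mark the vertices
  sent to \<open>True\<close>.
\<close>

definition code_cube :: "nat \<Rightarrow> (bool list \<Rightarrow> bool) \<Rightarrow> nat" where
  "code_cube n P = set_encode (to_nat ` {\<epsilon> \<in> vertices n. P \<epsilon>})"

definition cube_val :: "nat \<Rightarrow> bool list \<Rightarrow> bool" where
  "cube_val c \<epsilon> \<longleftrightarrow> to_nat \<epsilon> \<in> set_decode c"

definition codiscrete :: "nat presheaf" where
  "codiscrete = \<lparr>cubes = (\<lambda>n. range (code_cube n)),
     pull = (\<lambda>m n f c. code_cube m (\<lambda>\<epsilon>. cube_val c (f \<epsilon>)))\<rparr>"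

text \<open>The value \<open>undefined\<close> serves as an arbitrary letter of the nonempty alphabet.\<close>

definition const_lbl :: "nat \<Rightarrow> nat \<Rightarrow> 'a list" where
  "const_lbl n c = replicate n undefined"

lemma cube_val_code:
  assumes "\<epsilon> \<in> vertices n"
  shows "cube_val (code_cube n P) \<epsilon> = P \<epsilon>"
proof -
  have "finite {\<epsilon> :: bool list. set \<epsilon> \<subseteq> UNIV \<and> length \<epsilon> = n}"
    by (rule finite_lists_length_eq) simp
  then have "finite (vertices n)" by (simp add: vertices_def)
  then show ?thesis
    using assms by (auto simp: cube_val_def code_cube_def set_encode_inverse)
qed

lemma code_cube_cong:
  assumes "\<And>\<epsilon>. \<epsilon> \<in> vertices n \<Longrightarrow> P \<epsilon> = Q \<epsilon>"
  shows "code_cube n P = code_cube n Q"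
proof -
  have "{\<epsilon> \<in> vertices n. P \<epsilon>} = {\<epsilon> \<in> vertices n. Q \<epsilon>}" using assms by blast
  then show ?thesis by (simp add: code_cube_def)
qed

lemma code_cube_val: "c \<in> cubes codiscrete n \<Longrightarrow> code_cube n (cube_val c) = c"
  by (auto simp: codiscrete_def cube_val_code intro: code_cube_cong)

lemma code_cube_in [simp]: "code_cube n P \<in> cubes codiscrete n"
  by (simp add: codiscrete_def)

lemma codiscrete_cube_eqI:
  assumes "c \<in> cubes codiscrete n" "c' \<in> cubes codiscrete n"
    and "\<And>\<epsilon>. \<epsilon> \<in> vertices n \<Longrightarrow> cube_val c \<epsilon> = cube_val c' \<epsilon>"
  shows "c = c'"
proof -
  have "code_cube n (cube_val c) = code_cube n (cube_val c')"
    by (rule code_cube_cong) (rule assms(3))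
  then show ?thesis using assms(1,2) by (simp add: code_cube_val)
qed

lemma pull_codiscrete_in: "pull codiscrete m n f c \<in> cubes codiscrete m"
  by (simp add: codiscrete_def)

lemma cube_val_pull:
  "\<epsilon> \<in> vertices m \<Longrightarrow> cube_val (pull codiscrete m n f c) \<epsilon> = cube_val c (f \<epsilon>)"
  by (simp add: codiscrete_def cube_val_code)

lemma sym_precubical_codiscrete: "sym_precubical codiscrete"
  unfolding sym_precubical_def
proof (intro conjI allI impI ballI)
  show "pull codiscrete n n (restrict id (vertices n)) c = c" if "c \<in> cubes codiscrete n" for n c
    by (rule codiscrete_cube_eqI[OF pull_codiscrete_in that]) (simp add: cube_val_pull)
  show "pull codiscrete l n (compose (vertices l) g f) c
      = pull codiscrete l m f (pull codiscrete m n g c)"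
    if "box_hom l m f" for l m n f g c
    by (rule codiscrete_cube_eqI[OF pull_codiscrete_in pull_codiscrete_in])
       (simp add: cube_val_pull compose_eq box_hom_vertices[OF that])
qed (rule pull_codiscrete_in)

lemma labelled_codiscrete: "labelled codiscrete const_lbl"
  unfolding labelled_def precubical_map_def
  by (auto simp: sym_precubical_codiscrete bang_def const_lbl_def hat_preimage(1)
      intro!: nth_equalityI)

section \<open>The HDA paradigm\<close>

definition vertex_map :: "bool list \<Rightarrow> bool list \<Rightarrow> bool list" where
  "vertex_map \<epsilon> = restrict (\<lambda>_. \<epsilon>) (vertices 0)"

lemma box_hom_vertex_map: "box_hom 0 (length \<epsilon>) (vertex_map \<epsilon>)"
proof (induction \<epsilon>)
  case Nil
  have "vertex_map [] = restrict id (vertices 0)"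
    by (auto simp: vertex_map_def vertices_def fun_eq_iff)
  then show ?case using box_hom.ident[of 0] by (simp only: list.size)
next
  case (Cons b \<epsilon>)
  have "vertex_map (b # \<epsilon>) = compose (vertices 0) (face (length \<epsilon>) 0 b) (vertex_map \<epsilon>)"
    by (auto simp: vertex_map_def face_def vertices_def compose_def fun_eq_iff)
  then show ?case
    using box_hom.comp[OF Cons.IH box_hom.face[of 0 "length \<epsilon>" b]] by simp
qed

lemma codiscrete_lift_unique:
  assumes p: "0 < p" and x: "x \<in> cubes (std_cube p) n"
    and k: "is_lift p codiscrete lbl g h k" and k': "is_lift p codiscrete lbl g h k'"
  shows "k n x = k' n x"
proof -
  have lift: "precubical_map (std_cube p) codiscrete l"
    "\<forall>m. \<forall>y \<in> cubes (boundary p) m. l m y = g m y"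
    if "is_lift p codiscrete lbl g h l" for l
    using that unfolding is_lift_def by - (elim conjE, assumption)+
  note lift_map = lift(1)[unfolded precubical_map_def, THEN conjunct2, rule_format]
    and lift_in = lift(1)[unfolded precubical_map_def, THEN conjunct1, rule_format]
    and lift_boundary = lift(2)[rule_format]
  \<comment> \<open>The vertices of \<open>x\<close> are 0-cubes of the boundary, where a lift has no freedom.\<close>
  have val: "cube_val (l n x) \<epsilon> = cube_val (g 0 (compose (vertices 0) x (vertex_map \<epsilon>))) []"
    if l: "is_lift p codiscrete lbl g h l" and \<epsilon>: "\<epsilon> \<in> vertices n" for l \<epsilon>
  proof -
    let ?v = "compose (vertices 0) x (vertex_map \<epsilon>)"
    have nil: "[] \<in> vertices 0" by (simp add: vertices_def)
    have v: "box_hom 0 n (vertex_map \<epsilon>)"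
      using box_hom_vertex_map[of \<epsilon>] \<epsilon> by (simp add: vertices_def)
    have "box_hom n p x" using x by (simp add: std_cube_def)
    then have "box_hom 0 p ?v" by (rule box_hom.comp[OF v])
    then have "?v \<in> cubes (boundary p) 0"
      using p by (simp add: boundary_def std_cube_def)
    from lift_boundary[OF l this] have "g 0 ?v = l 0 ?v" ..
    also have "\<dots> = l 0 (pull (std_cube p) 0 n (vertex_map \<epsilon>) x)"
      by (simp add: std_cube_def)
    also have "\<dots> = pull codiscrete 0 n (vertex_map \<epsilon>) (l n x)"
      by (rule lift_map[OF l v x])
    finally have "cube_val (g 0 ?v) [] = cube_val (l n x) (vertex_map \<epsilon> [])"
      by (simp only: cube_val_pull[OF nil])
    then show ?thesis using nil by (simp only: vertex_map_def restrict_apply if_True)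
  qed
  show "k n x = k' n x"
    by (rule codiscrete_cube_eqI[OF lift_in[OF k x] lift_in[OF k' x]]) (simp only: val[OF k] val[OF k'])
qed

theorem codiscrete_HDA_paradigm: "HDA_paradigm codiscrete lbl"
proof -
  have "\<forall>n. \<forall>x \<in> cubes (std_cube p) n. k n x = k' n x"
    if "2 \<le> p" "is_lift p codiscrete lbl g h k" "is_lift p codiscrete lbl g h k'" for p g h k k'
    using codiscrete_lift_unique[OF _ _ that(2,3)] that(1) by simp
  then show ?thesis unfolding HDA_paradigm_def by blast
qed

section \<open>The realization\<close>

abbreviation point_state :: "bool \<Rightarrow> (nat \<times> nat \<times> bool list) set" where
  "point_state b \<equiv> state_in codiscrete 0 (code_cube 0 (\<lambda>_. b)) []"

lemma codiscrete_state_in: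
  assumes c: "c \<in> cubes codiscrete n" and \<epsilon>: "\<epsilon> \<in> vertices n"
  shows "state_in codiscrete n c \<epsilon> = point_state (cube_val c \<epsilon>)"
proof -
  have v: "box_hom 0 n (vertex_map \<epsilon>)"
    using box_hom_vertex_map[of \<epsilon>] \<epsilon> by (simp add: vertices_def)
  have nil: "[] \<in> vertices 0" by (simp add: vertices_def)
  have "pull codiscrete 0 n (vertex_map \<epsilon>) c = code_cube 0 (\<lambda>_. cube_val c \<epsilon>)"
    by (rule codiscrete_cube_eqI[OF pull_codiscrete_in code_cube_in])
       (simp add: cube_val_pull cube_val_code vertex_map_def)
  then show ?thesis
    using state_in_step[OF v c nil] nil by (simp add: vertex_map_def)
qed

text \<open>The point at a vertex is invariant under the identifications defining the states.\<close>

lemma codiscrete_states_distinct: "point_state False \<noteq> point_state True"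
proof
  let ?v = "\<lambda>(n :: nat, c, \<epsilon>). cube_val c \<epsilon>"
  assume "point_state False = point_state True"
  moreover have "(0, code_cube 0 (\<lambda>_. True), []) \<in> point_state True"
    by (simp add: state_in_def state_eq_def equiv_closure_def)
  ultimately have "((0, code_cube 0 (\<lambda>_. False), []), (0, code_cube 0 (\<lambda>_. True), []))
      \<in> state_eq codiscrete"
    unfolding state_in_def by blast
  then have "?v (0, code_cube 0 (\<lambda>_. False), []) = ?v (0, code_cube 0 (\<lambda>_. True), [])"
    unfolding state_eq_def
    by (rule equiv_closure_invariant[where v = ?v]) (auto simp: cube_val_pull)
  then show False by (simp add: cube_val_code vertices_def)
qed

abbreviation edge_action :: "nat \<Rightarrow> (nat \<times> nat \<times> 'a \<times> nat) set" where
  "edge_action c \<equiv> action_in codiscrete const_lbl 1 c (undefined, 0)"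

text \<open>
  The side of a square on which coordinate \<open>i\<close> is fixed carries the action of the other coordinate.
\<close>

lemma codiscrete_square_action:
  assumes d: "d \<in> cubes codiscrete 2" and i: "i \<le> 1"
  shows "action_in codiscrete const_lbl 2 d (undefined :: 'a, 1 - i)
    = edge_action (pull codiscrete 1 2 (face 1 i b) d)"
proof -
  have f: "box_hom 1 2 (face 1 i b)"
    using box_hom.face[of i 1 b] i by (simp add: numeral_2_eq_2)
  have "hat_preimage 1 2 (face 1 i b) 0 = 1 - i"
    using i by (intro hat_preimage_eqI f)
      (auto simp: face_def vertices_def nth_append nth_Cons' le_Suc_eq)
  then show ?thesis
    using action_in_step[OF f d, of "(undefined :: 'a, 0)" const_lbl]
    by (simp add: cube_map_action_def const_lbl_def)
qed

theorem codiscrete_one_action: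
  assumes c: "c \<in> cubes codiscrete 1" and c': "c' \<in> cubes codiscrete 1"
  shows "edge_action c = (edge_action c' :: (nat \<times> nat \<times> 'a \<times> nat) set)"
proof -
  \<comment> \<open>the square with \<open>c\<close> and \<open>c'\<close> as opposite sides\<close>
  define d where "d = code_cube 2 (\<lambda>\<epsilon>. cube_val (if hd \<epsilon> then c' else c) (tl \<epsilon>))"
  have d: "d \<in> cubes codiscrete 2" by (simp add: d_def)
  have side: "pull codiscrete 1 2 (face 1 0 b) d = (if b then c' else c)" for b
    by (rule codiscrete_cube_eqI[OF pull_codiscrete_in])
       (use c c' in \<open>auto simp: cube_val_pull d_def cube_val_code face_def vertices_def\<close>)
  have "edge_action (if b then c' else c)
      = (action_in codiscrete const_lbl 2 d (undefined, 1 - 0) :: (nat \<times> nat \<times> 'a \<times> nat) set)" for b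
    unfolding side[symmetric] by (rule codiscrete_square_action[symmetric, OF d]) simp
  from this[of False] this[of True] show ?thesis by simp
qed

lemma realization_transI:
  assumes "x \<in> cubes K n" "(\<alpha>, us, \<beta>) \<in> trans (cube_ts (lbl n x))"
  shows "(state_in K n x \<alpha>, map (action_in K lbl n x) us, state_in K n x \<beta>)
    \<in> trans (realization K lbl)"
  unfolding realization_def hdts.simps by (rule whdts_closure.gen) (use assms in blast)

text \<open>
  The edge \<open>e\<close> only serves to name the common action: the transition itself comes from the edge,
  respectively from a square, with the prescribed extreme corners.
\<close>

lemma codiscrete_edge_trans:
  assumes e: "e \<in> cubes codiscrete 1"
  shows "(point_state s, [edge_action e], point_state t) \<in> trans (realization codiscrete const_lbl)"
proof -
  define c where "c = code_cube 1 (\<lambda>\<epsilon>. if hd \<epsilon> then t else s)"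
  have c: "c \<in> cubes codiscrete 1" unfolding c_def by (rule code_cube_in)
  have v: "[b] \<in> vertices 1" for b by (simp add: vertices_def)
  have corner: "state_in codiscrete 1 c [b] = point_state (if b then t else s)" for b
    unfolding codiscrete_state_in[OF c v] unfolding c_def cube_val_code[OF v] list.sel ..
  have "([False], [(undefined, 0)], [True]) \<in> trans (cube_ts (const_lbl 1 c))"
    by (simp add: cube_trans_iff const_lbl_def)
  from realization_transI[where lbl = const_lbl, OF c this] show ?thesis
    unfolding corner list.map if_True if_False codiscrete_one_action[OF c e] .
qed

lemma codiscrete_square_trans:
  assumes e: "e \<in> cubes codiscrete 1"
  shows "(point_state s, [edge_action e, edge_action e], point_state t)
    \<in> trans (realization codiscrete const_lbl)"
proof -
  define d where "d = code_cube 2 (\<lambda>\<epsilon>. if hd \<epsilon> then t else s)"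
  have d: "d \<in> cubes codiscrete 2" unfolding d_def by (rule code_cube_in)
  have v: "[b, b] \<in> vertices 2" for b by (simp add: vertices_def)
  have corner: "state_in codiscrete 2 d [b, b] = point_state (if b then t else s)" for b
    unfolding codiscrete_state_in[OF d v] unfolding d_def cube_val_code[OF v] list.sel ..
  have "action_in codiscrete const_lbl 2 d (undefined, 1 - i) = edge_action e" if "i \<le> 1" for i
    unfolding codiscrete_square_action[OF d that, of False]
    by (rule codiscrete_one_action[OF pull_codiscrete_in e])
  from this[of 0] this[of 1]
  have action: "action_in codiscrete const_lbl 2 d (undefined, 0) = edge_action e"
    "action_in codiscrete const_lbl 2 d (undefined, 1) = edge_action e" by simp_all
  have "([False, False], [(undefined, 0), (undefined, 1)], [True, True])
      \<in> trans (cube_ts (const_lbl 2 d))"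
    by (auto simp: cube_trans_iff const_lbl_def less_2_cases_iff)
  from realization_transI[where lbl = const_lbl, OF d this] show ?thesis
    unfolding corner list.map if_True if_False action .
qed

theorem codiscrete_not_strong: "\<not> strong codiscrete (const_lbl :: nat \<Rightarrow> nat \<Rightarrow> 'a list)"
proof
  define U :: "(nat \<times> nat \<times> 'a \<times> nat) set" where "U = edge_action (code_cube 1 (\<lambda>_. False))"
  let ?X = "realization codiscrete (const_lbl :: nat \<Rightarrow> nat \<Rightarrow> 'a list)"
  have edge: "(point_state s, [U], point_state t) \<in> trans ?X" for s t
    unfolding U_def by (rule codiscrete_edge_trans) simp
  have square: "(point_state s, [U, U], point_state t) \<in> trans ?X" for s t
    unfolding U_def by (rule codiscrete_square_trans) simp
  have states: "point_state s \<in> states ?X" for s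
    unfolding realization_states using code_cube_in by (fastforce simp: vertices_def)
  assume "strong codiscrete (const_lbl :: nat \<Rightarrow> nat \<Rightarrow> 'a list)"
  from this[unfolded strong_def unique_intermediate_state_def, rule_format,
      of "[U, U]" 1 "point_state False" "point_state False"] square
  have "\<exists>!\<nu>. \<nu> \<in> states ?X \<and> (point_state False, [U], \<nu>) \<in> trans ?X
      \<and> (\<nu>, [U], point_state False) \<in> trans ?X" by simp
  then have "point_state False = point_state True" using edge states by blast
  then show False using codiscrete_states_distinct by simp
qed

theorem proposition9p7:
  shows "\<exists>(K :: nat presheaf) (lbl :: nat \<Rightarrow> nat \<Rightarrow> 'a list).
           labelled K lbl \<and> HDA_paradigm K lbl \<and> \<not> strong K lbl"
  using labelled_codiscrete codiscrete_HDA_paradigm codiscrete_not_strong by blast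

end
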